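(* There is no polynomial-time algorithm for computing a $0$-best (i.e., optimal) solution of the nonlinear optimization problem $\min\{f(wx) : x\in S\}$ over an independence system $S\subseteq\{0,1\}^n$ presented by a linear-optimization oracle, with $f:\mathbb{Z}\rightarrow\mathbb{R}$ presented by a comparison oracle and weight vector $w\in\{2,3\}^n$. In fact, to solve this nonlinear optimization problem over every independence system $S$ with a ground set of $n=4m$ elements with $m\geq 2$, at least $\binom{2m}{m+1}\geq 2^m$ queries of the oracle presenting $S$ are needed.
   Context: An independence system (with ground set $\{1,\dots,n\}$) is a nonempty set $S\subseteq\{0,1\}^n$ such that $x\in\{0,1\}^n$ and $x\le y\in S$ (componentwise) imply $x\in S$. For $v\in\mathbb{Z}^n$ and $x\in\{0,1\}^n$, $vx:=\sum_{j=1}^n v_jx_j$. A linear-optimization oracle for $S$, queried on $v\in\mathbb{Z}^n$, returns an element $x\in S$ maximizing $vx$ over $S$. A comparison oracle for $f$, queried on $x,y\in\mathbb{Z}$, asserts whether or not $f(x)\le f(y)$. The algorithm accesses $S$ and $f$ only through these oracles, and running time is measured in the usual oracle model, each oracle query counting as one step. A $0$-best (optimal) solution is a point $x^*\in S$ such that $f(wx^* )\le f(wx)$ for all $x\in S$. The query lower bound is a worst-case bound: it says that any algorithm that correctly solves the problem for all such instances must make at least this many linear-optimization oracle queries on some instance with $n=4m$. *)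

theory Defs
  imports Complex_Main "HOL-Computational_Algebra.Polynomial"
begin

section \<open>The optimization problem\<close>

text \<open>Vectors of length \<open>n\<close> are lists of length \<open>n\<close>; coordinates are indexed by \<open>0, \<dots>, n - 1\<close>.\<close>

definition vectors_over :: "int set \<Rightarrow> nat \<Rightarrow> int list set" where
  "vectors_over A n = {x. set x \<subseteq> A \<and> length x = n}"

definition dot :: "int list \<Rightarrow> int list \<Rightarrow> int" where
  "dot v x = (\<Sum>j<length x. v ! j * x ! j)"

definition independence_system :: "nat \<Rightarrow> int list set \<Rightarrow> bool" where
  "independence_system n S \<longleftrightarrow>
     S \<noteq> {} \<and> S \<subseteq> vectors_over {0, 1} n \<and>
     (\<forall>x \<in> vectors_over {0, 1} n. \<forall>y \<in> S. list_all2 (\<le>) x y \<longrightarrow> x \<in> S)"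

definition zero_best :: "(int \<Rightarrow> real) \<Rightarrow> int list \<Rightarrow> int list set \<Rightarrow> int list \<Rightarrow> bool" where
  "zero_best f w S x \<longleftrightarrow> x \<in> S \<and> (\<forall>y \<in> S. f (dot w x) \<le> f (dot w y))"

text \<open>An oracle may return any maximizer. Its answers to lists that are not in \<open>\<int>\<^sup>n\<close> are
  unspecified.\<close>

definition linear_optimization_oracle ::
    "nat \<Rightarrow> int list set \<Rightarrow> (int list \<Rightarrow> int list) \<Rightarrow> bool" where
  "linear_optimization_oracle n S L \<longleftrightarrow>
     (\<forall>v. length v = n \<longrightarrow> L v \<in> S \<and> (\<forall>x \<in> S. dot v x \<le> dot v (L v)))"

definition comparison_oracle :: "(int \<Rightarrow> real) \<Rightarrow> int \<Rightarrow> int \<Rightarrow> bool" where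
  "comparison_oracle f a b \<longleftrightarrow> f a \<le> f b"

text \<open>The function \<open>f\<close> is unrestricted and hence does not occur here.\<close>

definition problem_instance ::
    "nat \<Rightarrow> int list \<Rightarrow> int list set \<Rightarrow> (int list \<Rightarrow> int list) \<Rightarrow> bool" where
  "problem_instance n w S L \<longleftrightarrow>
     w \<in> vectors_over {2, 3} n \<and> independence_system n S \<and> linear_optimization_oracle n S L"


section \<open>Deterministic oracle algorithms\<close>

text \<open>A deterministic algorithm is given by a transition function on configurations of an arbitrary
  type \<open>'c\<close>. In each step it changes its configuration on its own, or asks one of the two oracles
  and continues with a configuration depending on the answer, or halts with an output. The
  input is the weight vector \<open>w\<close>, whose length is \<open>n\<close>.\<close>

datatype 'c action =
    Internal 'c
  | AskLinOpt "int list" "int list \<Rightarrow> 'c"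
  | AskCompare int int "bool \<Rightarrow> 'c"
  | Halt "int list"

text \<open>\<open>run \<delta> L C c t q x\<close>: started in configuration \<open>c\<close>, the algorithm halts with output \<open>x\<close> after
  \<open>t\<close> steps (every oracle query being one step), \<open>q\<close> of which are linear-optimization queries.\<close>

inductive run ::
    "('c \<Rightarrow> 'c action) \<Rightarrow> (int list \<Rightarrow> int list) \<Rightarrow> (int \<Rightarrow> int \<Rightarrow> bool) \<Rightarrow>
     'c \<Rightarrow> nat \<Rightarrow> nat \<Rightarrow> int list \<Rightarrow> bool"
  for \<delta> L C where
  halt: "\<delta> c = Halt x \<Longrightarrow> run \<delta> L C c 0 0 x"
| internal: "\<delta> c = Internal c' \<Longrightarrow> run \<delta> L C c' t q x \<Longrightarrow> run \<delta> L C c (Suc t) q x"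
| lin_opt: "\<delta> c = AskLinOpt v k \<Longrightarrow> run \<delta> L C (k (L v)) t q x \<Longrightarrow> run \<delta> L C c (Suc t) (Suc q) x"
| compare: "\<delta> c = AskCompare a b k \<Longrightarrow> run \<delta> L C (k (C a b)) t q x \<Longrightarrow> run \<delta> L C c (Suc t) q x"

definition solves :: "(int list \<Rightarrow> 'c) \<Rightarrow> ('c \<Rightarrow> 'c action) \<Rightarrow> nat \<Rightarrow> bool" where
  "solves init \<delta> n \<longleftrightarrow>
     (\<forall>w S L f. problem_instance n w S L \<longrightarrow>
        (\<exists>t q x. run \<delta> L (comparison_oracle f) (init w) t q x \<and> zero_best f w S x))"

text \<open>Since \<open>w\<close> is in \<open>{2, 3}\<^sup>n\<close>, the input size is proportional to \<open>n\<close>.\<close>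

definition polynomial_time :: "(int list \<Rightarrow> 'c) \<Rightarrow> ('c \<Rightarrow> 'c action) \<Rightarrow> bool" where
  "polynomial_time init \<delta> \<longleftrightarrow>
     (\<exists>p :: nat poly. \<forall>n \<ge> 1. \<forall>w S L f t q x. problem_instance n w S L \<longrightarrow>
        run \<delta> L (comparison_oracle f) (init w) t q x \<longrightarrow> t \<le> poly p n)"


section \<open>Oracle Turing machines\<close>

text \<open>Two tapes, infinite in both directions: a work tape, holding the input and at the end the
  output, and an oracle tape, on which a query is replaced by its answer. Fixing the alphabet
  changes running times by a constant factor only.\<close>

datatype symbol = Blank | Zero | One | Minus | Sep

text \<open>Binary, least significant digit first. The number 0 is the empty word.\<close>

fun encode_nat :: "nat \<Rightarrow> symbol list" where
  "encode_nat k = (if k = 0 then [] else (if even k then Zero else One) # encode_nat (k div 2))"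

declare encode_nat.simps [simp del]

definition encode_int :: "int \<Rightarrow> symbol list" where
  "encode_int z = (if z < 0 then [Minus] else []) @ encode_nat (nat \<bar>z\<bar>)"

definition encode :: "int list \<Rightarrow> symbol list" where
  "encode v = concat (map (\<lambda>z. encode_int z @ [Sep]) v)"

definition decode :: "symbol list \<Rightarrow> int list option" where
  "decode u = (if \<exists>v. encode v = u then Some (THE v. encode v = u) else None)"

text \<open>\<open>Tape l r\<close>: \<open>r\<close> is the content from the scanned cell rightwards, \<open>l\<close> the content to the left of
  it, nearest cell first; all further cells are blank.\<close>

datatype tape = Tape "symbol list" "symbol list"

datatype direction = Left | Stay | Right

fun scanned :: "tape \<Rightarrow> symbol" where
  "scanned (Tape l []) = Blank"
| "scanned (Tape l (a # r)) = a"

fun write_move :: "symbol \<Rightarrow> direction \<Rightarrow> tape \<Rightarrow> tape" where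
  "write_move a Stay (Tape l r) = Tape l (a # tl r)"
| "write_move a Right (Tape l r) = Tape (a # l) (tl r)"
| "write_move a Left (Tape [] r) = Tape [] (Blank # a # tl r)"
| "write_move a Left (Tape (b # l) r) = Tape l (b # a # tl r)"

fun word_at_head :: "tape \<Rightarrow> symbol list" where
  "word_at_head (Tape l r) = takeWhile (\<lambda>a. a \<noteq> Blank) r"

datatype instruction =
    Step nat symbol direction symbol direction
  | QueryLinOpt nat
  | QueryCompare nat
  | Stop

text \<open>A program assigns an instruction to the state, the symbol scanned on the work tape and the
  symbol scanned on the oracle tape. The number in an instruction is the next state, and
  \<open>Step\<close> lists the actions on the work tape before those on the oracle tape.\<close>

type_synonym program = "nat \<Rightarrow> symbol \<Rightarrow> symbol \<Rightarrow> instruction"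

fun target_states :: "instruction \<Rightarrow> nat set" where
  "target_states (Step s a d b e) = {s}"
| "target_states (QueryLinOpt s) = {s}"
| "target_states (QueryCompare s) = {s}"
| "target_states Stop = {}"

text \<open>\<open>{..<N}\<close> is the finite set of states, and 0 is the initial state.\<close>

definition oracle_turing_machine :: "nat \<Rightarrow> program \<Rightarrow> bool" where
  "oracle_turing_machine N P \<longleftrightarrow>
     0 < N \<and> (\<forall>s < N. \<forall>a b. target_states (P s a b) \<subseteq> {..<N})"

type_synonym configuration = "nat \<times> tape \<times> tape"

definition tm_init :: "int list \<Rightarrow> configuration" where
  "tm_init w = (0, Tape [] (encode w), Tape [] [])"

text \<open>Words that encode no query are erased without an answer. A halting machine whose work tape
  shows no encoding of a vector outputs the empty list, which is never a solution for \<open>n \<ge> 1\<close>.\<close>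

fun tm_step :: "program \<Rightarrow> configuration \<Rightarrow> configuration action" where
  "tm_step P (s, W, Q) =
     (case P s (scanned W) (scanned Q) of
        Step s' a d b e \<Rightarrow> Internal (s', write_move a d W, write_move b e Q)
      | QueryLinOpt s' \<Rightarrow>
          (case decode (word_at_head Q) of
             Some v \<Rightarrow> AskLinOpt v (\<lambda>x. (s', W, Tape [] (encode x)))
           | None \<Rightarrow> Internal (s', W, Tape [] []))
      | QueryCompare s' \<Rightarrow>
          (case decode (word_at_head Q) of
             Some [x, y] \<Rightarrow> AskCompare x y (\<lambda>b. (s', W, Tape [] [if b then One else Zero]))
           | _ \<Rightarrow> Internal (s', W, Tape [] []))
      | Stop \<Rightarrow>
          (case decode (word_at_head W) of Some x \<Rightarrow> Halt x | None \<Rightarrow> Halt []))"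

text \<open>The encoding is injective, and encodings contain no blanks.\<close>

lemma encode_nat_inject: "encode_nat k = encode_nat l \<Longrightarrow> k = l"
proof (induction k arbitrary: l rule: less_induct)
  case (less k)
  show ?case
  proof (cases "k = 0 \<or> l = 0")
    case True
    with less.prems show ?thesis
      by (auto simp: encode_nat.simps[of k] encode_nat.simps[of l] split: if_splits)
  next
    case False
    with less.prems have "even k = even l" "encode_nat (k div 2) = encode_nat (l div 2)"
      by (auto simp: encode_nat.simps[of k] encode_nat.simps[of l] split: if_splits)
    moreover from this(2) have "k div 2 = l div 2"
      using less.IH[of "k div 2"] False by simp
    ultimately show ?thesis
      by (metis div_mult_mod_eq parity_cases)
  qed
qed

lemma set_encode_nat: "set (encode_nat k) \<subseteq> {Zero, One}"
  by (induction k rule: encode_nat.induct) (subst encode_nat.simps, auto)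

lemma set_encode_int: "set (encode_int z) \<subseteq> {Zero, One, Minus}"
  using set_encode_nat[of "nat \<bar>z\<bar>"] by (auto simp: encode_int_def)

lemma encode_int_inject:
  assumes "encode_int y = encode_int z"
  shows "y = z"
proof -
  have no_minus: "encode_nat k \<noteq> Minus # u" for k u
    using set_encode_nat[of k] by auto
  from assms have "(y < 0) = (z < 0)" "encode_nat (nat \<bar>y\<bar>) = encode_nat (nat \<bar>z\<bar>)"
    using no_minus no_minus[symmetric] by (auto simp: encode_int_def split: if_splits)
  with encode_nat_inject show ?thesis
    by fastforce
qed

lemma encode_inject: "encode u = encode v \<Longrightarrow> u = v"
proof (induction u arbitrary: v)
  case Nil
  then show ?case by (cases v) (auto simp: encode_def)
next
  case (Cons y u)
  then obtain z v' where v: "v = z # v'"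
    by (cases v) (auto simp: encode_def)
  have eq: "encode_int y @ Sep # encode u = encode_int z @ Sep # encode v'"
    using Cons.prems by (simp add: v encode_def)
  have split: "takeWhile (\<lambda>a. a \<noteq> Sep) (encode_int x @ Sep # w) = encode_int x" for x w
    using set_encode_int[of x] by (subst takeWhile_append2) auto
  from arg_cong[OF eq, of "takeWhile (\<lambda>a. a \<noteq> Sep)"] have "encode_int y = encode_int z"
    by (simp only: split)
  with eq Cons.IH encode_int_inject show ?case
    by (auto simp: v)
qed

lemma decode_encode: "decode (encode v) = Some v"
  using encode_inject by (auto simp: decode_def)

lemma blank_notin_encode: "Blank \<notin> set (encode v)"
proof -
  have "Blank \<notin> set (encode_int z)" for z
    using set_encode_int[of z] by auto
  then show ?thesis
    by (simp add: encode_def)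
qed

end

theory Submission
  imports Defs "HOL-Real_Asymp.Real_Asymp"
begin

text \<open>
  Both claims come from one adversary argument. Split the \<open>4m\<close> elements into a half of weight 2
  and a half of weight 3. Let \<open>S\<close> be the independence system of all sets with at most
  \<open>m\<close> elements in each half, or at most \<open>m + 2\<close> light and \<open>m - 2\<close> heavy ones. No
  member of \<open>S\<close> has weight \<open>5m - 1\<close>, but every set \<open>y\<close> with \<open>m + 1\<close> light
  and \<open>m - 1\<close> heavy elements has, and \<open>S \<union> {y}\<close> is again an independence system because
  all proper subsets of \<open>y\<close> are in \<open>S\<close>. If \<open>f\<close> prefers the value \<open>5m - 1\<close> to all
  others, then \<open>y\<close> is the only solution over \<open>S \<union> {y}\<close>, so that an algorithm has to
  distinguish \<open>S\<close> from each \<open>S \<union> {y}\<close> (\<open>adversary_bound\<close>).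

  A query \<open>v\<close> can tell \<open>S\<close> from \<open>S \<union> {y}\<close> only if \<open>y\<close> beats all of \<open>S\<close>
  under \<open>v\<close>. Exchanging a light element of one set for a heavy element of another shows that any two
  sets \<open>y\<close> beating \<open>S\<close> under the same \<open>v\<close> agree in the light or in the heavy half
  (\<open>beating_pairs_agree\<close>); hence all of them agree in one and the same half, and there are at most
  \<open>N = (2m choose (m + 1))\<close> of them. As there are \<open>N\<^sup>2\<close> candidates \<open>y\<close>, the algorithm
  makes at least \<open>N\<close> queries when it is run on \<open>S\<close>. Polynomial time is excluded because
  \<open>N \<ge> 2\<^sup>m\<close> exceeds every polynomial in \<open>4m\<close>.
\<close>

section \<open>Runs of oracle algorithms\<close>

lemma run_deterministic:
  assumes "run \<delta> L C c t q x" and "run \<delta> L C c t' q' x'"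
  shows "x' = x"
  using assms
proof (induction arbitrary: t' q')
  case (halt c x)
  from halt(2,1) show ?case by cases auto
next
  case (internal c c' t q x)
  from internal.prems internal.hyps internal.IH show ?case by cases auto
next
  case (lin_opt c v k t q x)
  from lin_opt.prems lin_opt.hyps lin_opt.IH show ?case by cases auto
next
  case (compare c a b k t q x)
  from compare.prems compare.hyps compare.IH show ?case by cases auto
qed

text \<open>A run sees of its linear-optimization oracle only the answers to the queries \<open>Q\<close> that it
  makes, so the adversary may change all other answers.\<close>

lemma run_queries:
  assumes "run \<delta> L C c t q x"
  obtains Q where "finite Q" "card Q \<le> q"
    "\<And>L'. (\<And>v. v \<in> Q \<Longrightarrow> L' v = L v) \<Longrightarrow> run \<delta> L' C c t q x"
proof -
  from assms have "\<exists>Q. finite Q \<and> card Q \<le> q \<and>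
      (\<forall>L'. (\<forall>v\<in>Q. L' v = L v) \<longrightarrow> run \<delta> L' C c t q x)"
  proof induction
    case (halt c x)
    then show ?case by (intro exI[of _ "{}"]) (auto intro: run.halt)
  next
    case (internal c c' t q x)
    then show ?case by (blast intro: run.internal)
  next
    case (lin_opt c v k t q x)
    from lin_opt.IH obtain Q where Q: "finite Q" "card Q \<le> q"
      "\<And>L'. \<forall>v\<in>Q. L' v = L v \<Longrightarrow> run \<delta> L' C (k (L v)) t q x"
      by blast
    have "run \<delta> L' C c (Suc t) (Suc q) x" if "\<forall>u\<in>insert v Q. L' u = L u" for L'
      using that Q(3)[of L'] lin_opt.hyps(1) by (metis insert_iff run.lin_opt)
    moreover have "card (insert v Q) \<le> Suc q"
      using Q(1,2) by (simp add: card_insert_if)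
    ultimately show ?case
      using Q(1) by (meson finite_insert)
  next
    case (compare c a b k t q x)
    from compare.IH obtain Q where Q: "finite Q" "card Q \<le> q"
      "\<And>L'. \<forall>v\<in>Q. L' v = L v \<Longrightarrow> run \<delta> L' C (k (C a b)) t q x"
      by blast
    have "run \<delta> L' C c (Suc t) q x" if "\<forall>v\<in>Q. L' v = L v" for L'
      using compare.hyps(1) Q(3)[OF that] by (rule run.compare)
    with Q(1,2) show ?case
      by blast
  qed
  then obtain Q where "finite Q" "card Q \<le> q"
    "\<And>L'. \<forall>v\<in>Q. L' v = L v \<Longrightarrow> run \<delta> L' C c t q x"
    by metis
  then show thesis
    by (intro that[of Q]) simp_all
qed

lemma run_queries_le_steps: "run \<delta> L C c t q x \<Longrightarrow> q \<le> t"
  by (induction rule: run.induct) auto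


section \<open>The adversary argument\<close>

definition beats :: "int list set \<Rightarrow> int list \<Rightarrow> int list \<Rightarrow> bool" where
  "beats S v y \<longleftrightarrow> (\<forall>x\<in>S. dot v x < dot v y)"

lemma linear_optimization_oracle_exists:
  assumes "finite S" "S \<noteq> {}"
  obtains L where "linear_optimization_oracle n S L"
proof -
  have "\<exists>z\<in>S. \<forall>x\<in>S. dot v x \<le> dot v z" for v
  proof -
    have "Max (dot v ` S) \<in> dot v ` S"
      using assms by (intro Max_in) auto
    then obtain z where "z \<in> S" "dot v z = Max (dot v ` S)"
      by force
    then show ?thesis
      using assms(1) by (metis Max_ge finite_imageI imageI)
  qed
  then show thesis
    using that unfolding linear_optimization_oracle_def by metis
qed

text \<open>The oracle answers need to change only at the queries at which \<open>y\<close> beats \<open>S\<close>: at all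
  others, an optimum over \<open>S\<close> is still one over \<open>S \<union> {y}\<close>.\<close>

lemma linear_optimization_oracle_insert:
  assumes "linear_optimization_oracle n S L"
  shows "linear_optimization_oracle n (insert y S)
           (\<lambda>v. if length v = n \<and> beats S v y then y else L v)"
  unfolding linear_optimization_oracle_def
proof (intro allI impI)
  fix v :: "int list"
  assume v: "length v = n"
  have L: "L v \<in> S" "\<And>x. x \<in> S \<Longrightarrow> dot v x \<le> dot v (L v)"
    using assms v by (auto simp: linear_optimization_oracle_def)
  show "(if length v = n \<and> beats S v y then y else L v) \<in> insert y S \<and>
    (\<forall>x\<in>insert y S. dot v x \<le> dot v (if length v = n \<and> beats S v y then y else L v))"
  proof (cases "beats S v y")
    case True
    then show ?thesis using v by (auto simp: beats_def intro: less_imp_le)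
  next
    case False
    then obtain x where "x \<in> S" "dot v y \<le> dot v x"
      by (auto simp: beats_def not_less)
    with L(2)[of x] have "dot v y \<le> dot v (L v)"
      by simp
    with False L show ?thesis
      by auto
  qed
qed

text \<open>If \<open>f\<close> is smallest only at \<open>k\<close>, then \<open>y\<close> is the unique solution over \<open>S \<union> {y}\<close>. So a
  run on \<open>S\<close> may halt only after every \<open>y \<in> T\<close> has beaten \<open>S\<close> at some query, and each query
  accounts for at most \<open>N\<close> of them.\<close>

lemma adversary_bound:
  assumes w: "w \<in> vectors_over {2, 3} n"
    and S: "independence_system n S" "finite S"
    and S_y: "\<And>y. y \<in> T \<Longrightarrow> independence_system n (insert y S)"
    and T: "finite T" "\<And>y. y \<in> T \<Longrightarrow> dot w y = k"
    and S_avoids: "\<And>x. x \<in> S \<Longrightarrow> dot w x \<noteq> k"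
    and few: "\<And>v. length v = n \<Longrightarrow> card {y \<in> T. beats S v y} \<le> N"
    and solves: "solves init \<delta> n"
  obtains L f t q x where "problem_instance n w S L"
    "run \<delta> L (comparison_oracle f) (init w) t q x" "card T \<le> q * N"
proof -
  define f :: "int \<Rightarrow> real" where "f = (\<lambda>a. if a = k then 0 else 1)"
  have "S \<noteq> {}"
    using S(1) by (simp add: independence_system_def)
  with S(2) obtain L where L: "linear_optimization_oracle n S L"
    using linear_optimization_oracle_exists by blast
  have pi: "problem_instance n w S L"
    using w S(1) L by (simp add: problem_instance_def)
  then obtain t q x where run: "run \<delta> L (comparison_oracle f) (init w) t q x"
    and x: "zero_best f w S x"
    using solves unfolding solves_def by blast
  obtain Q where Q: "finite Q" "card Q \<le> q"
    "\<And>L'. (\<And>v. v \<in> Q \<Longrightarrow> L' v = L v) \<Longrightarrow>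
      run \<delta> L' (comparison_oracle f) (init w) t q x"
    using run_queries[OF run] by blast
  define excluded where "excluded = (\<lambda>v. {y \<in> T. length v = n \<and> beats S v y})"
  have "T \<subseteq> (\<Union>v\<in>Q. excluded v)"
  proof
    fix y assume y: "y \<in> T"
    show "y \<in> (\<Union>v\<in>Q. excluded v)"
    proof (rule ccontr)
      assume not_excluded: "y \<notin> (\<Union>v\<in>Q. excluded v)"
      define L' where "L' = (\<lambda>v. if length v = n \<and> beats S v y then y else L v)"
      have "run \<delta> L' (comparison_oracle f) (init w) t q x"
        using not_excluded y by (intro Q(3)) (auto simp: L'_def excluded_def)
      moreover have "problem_instance n w (insert y S) L'"
        using w S_y[OF y] linear_optimization_oracle_insert[OF L]
        by (simp add: problem_instance_def L'_def)
      ultimately have "zero_best f w (insert y S) x"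
        using solves run_deterministic unfolding solves_def by metis
      then have "f (dot w x) \<le> f (dot w y)"
        by (simp add: zero_best_def)
      then have "dot w x = k"
        using T(2)[OF y] by (simp add: f_def split: if_splits)
      then show False
        using x S_avoids by (simp add: zero_best_def)
    qed
  qed
  then have "card T \<le> card (\<Union>v\<in>Q. excluded v)"
    using T(1) Q(1) by (intro card_mono) (auto simp: excluded_def)
  also have "\<dots> \<le> (\<Sum>v\<in>Q. card (excluded v))"
    using Q(1) by (rule card_UN_le)
  also have "\<dots> \<le> (\<Sum>v\<in>Q. N)"
  proof (rule sum_mono)
    show "card (excluded v) \<le> N" for v
      using few[of v] by (cases "length v = n") (auto simp: excluded_def)
  qed
  also have "\<dots> \<le> q * N"
    using Q(2) by simp
  finally show thesis
    using that pi run by blast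
qed


section \<open>Characteristic vectors\<close>

definition char_vec :: "nat \<Rightarrow> nat set \<Rightarrow> int list" where
  "char_vec n X = map (\<lambda>j. if j \<in> X then 1 else 0) [0..<n]"

lemma length_char_vec [simp]: "length (char_vec n X) = n"
  by (simp add: char_vec_def)

lemma nth_char_vec [simp]: "j < n \<Longrightarrow> char_vec n X ! j = (if j \<in> X then 1 else 0)"
  by (simp add: char_vec_def)

lemma vectors_over_01: "vectors_over {0, 1} n = char_vec n ` Pow {..<n}"
proof (intro equalityI subsetI)
  fix x assume "x \<in> vectors_over {0, 1} n"
  then have x: "set x \<subseteq> {0, 1}" "length x = n"
    by (auto simp: vectors_over_def)
  have "x ! j \<in> {0, 1}" if "j < n" for j
    using x that nth_mem by blast
  then have "x = char_vec n {j. j < n \<and> x ! j = 1}"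
    using x(2) by (intro nth_equalityI) auto
  then show "x \<in> char_vec n ` Pow {..<n}"
    by blast
qed (auto simp: vectors_over_def char_vec_def)

lemma char_vec_le_iff:
  assumes "X \<subseteq> {..<n}"
  shows "list_all2 (\<le>) (char_vec n X) (char_vec n Y) \<longleftrightarrow> X \<subseteq> Y"
  using assms by (force simp: list_all2_conv_all_nth subset_iff split: if_splits)

lemma inj_on_char_vec: "inj_on (char_vec n) (Pow {..<n})"
  by (rule inj_onI) (metis PowD char_vec_le_iff order_refl subset_antisym)

lemma independence_system_char_vec:
  assumes "F \<noteq> {}" "F \<subseteq> Pow {..<n}" "\<And>X Y. X \<subseteq> Y \<Longrightarrow> Y \<in> F \<Longrightarrow> X \<in> F"
  shows "independence_system n (char_vec n ` F)"
  using assms by (auto simp: independence_system_def vectors_over_01 char_vec_le_iff)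

lemma dot_char_vec:
  assumes "X \<subseteq> {..<n}"
  shows "dot v (char_vec n X) = (\<Sum>j\<in>X. v ! j)"
proof -
  have "dot v (char_vec n X) = (\<Sum>j<n. if j \<in> X then v ! j else 0)"
    by (auto simp: dot_def intro: sum.cong)
  also have "\<dots> = (\<Sum>j\<in>{..<n} \<inter> X. v ! j)"
    by (simp add: sum.inter_restrict)
  finally show ?thesis
    using assms by (simp add: Int_absorb1)
qed


section \<open>The hard instance\<close>

definition light :: "nat \<Rightarrow> nat set" where "light m = {..<2 * m}"
definition heavy :: "nat \<Rightarrow> nat set" where "heavy m = {2 * m..<4 * m}"

definition hard_weights :: "nat \<Rightarrow> int list" where
  "hard_weights m = replicate (2 * m) 2 @ replicate (2 * m) 3"

definition hard_family :: "nat \<Rightarrow> nat set set" where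
  "hard_family m = {X. X \<subseteq> {..<4 * m} \<and>
     (card (X \<inter> light m) \<le> m \<and> card (X \<inter> heavy m) \<le> m \<or>
      card (X \<inter> light m) \<le> m + 2 \<and> card (X \<inter> heavy m) + 2 \<le> m)}"

text \<open>The sets that may be added are kept as pairs of their parts in the two halves, because the
  counting argument treats the parts separately.\<close>

definition candidates :: "nat \<Rightarrow> (nat set \<times> nat set) set" where
  "candidates m = {A. A \<subseteq> light m \<and> card A = m + 1} \<times> {B. B \<subseteq> heavy m \<and> card B = m - 1}"

lemma finite_halves [simp]: "finite (light m)" "finite (heavy m)"
  by (auto simp: light_def heavy_def)

lemma halves: "light m \<union> heavy m = {..<4 * m}" "light m \<inter> heavy m = {}"
  by (auto simp: light_def heavy_def)

lemma candidate_Int: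
  assumes "A \<subseteq> light m" "B \<subseteq> heavy m"
  shows "(A \<union> B) \<inter> light m = A" "(A \<union> B) \<inter> heavy m = B"
  using assms halves(2)[of m] by auto

lemma candidate_subset:
  assumes "A \<subseteq> light m" "B \<subseteq> heavy m"
  shows "A \<union> B \<subseteq> {..<4 * m}"
  using assms halves(1)[of m] by auto

lemma inj_on_candidates: "inj_on (\<lambda>(A, B). char_vec (4 * m) (A \<union> B)) (candidates m)"
proof (rule inj_onI, clarify)
  fix A B U V
  assume "(A, B) \<in> candidates m" "(U, V) \<in> candidates m"
    and eq: "char_vec (4 * m) (A \<union> B) = char_vec (4 * m) (U \<union> V)"
  then have *: "A \<subseteq> light m" "B \<subseteq> heavy m" "U \<subseteq> light m" "V \<subseteq> heavy m"
    by (auto simp: candidates_def)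
  have "A \<union> B = U \<union> V"
    using inj_onD[OF inj_on_char_vec eq] candidate_subset * by blast
  then show "A = U \<and> B = V"
    using candidate_Int * by metis
qed

lemma card_candidate_parts:
  assumes "m \<ge> 1"
  shows "card {A. A \<subseteq> light m \<and> card A = m + 1} = (2 * m) choose (m + 1)"
    and "card {B. B \<subseteq> heavy m \<and> card B = m - 1} = (2 * m) choose (m + 1)"
proof -
  show "card {A. A \<subseteq> light m \<and> card A = m + 1} = (2 * m) choose (m + 1)"
    by (subst n_subsets) (auto simp: light_def)
  have "card {B. B \<subseteq> heavy m \<and> card B = m - 1} = (2 * m) choose (m - 1)"
    by (subst n_subsets) (auto simp: heavy_def)
  also have "\<dots> = (2 * m) choose (m + 1)"
    using assms by (subst binomial_symmetric) (auto intro: arg_cong2[where f = binomial])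
  finally show "card {B. B \<subseteq> heavy m \<and> card B = m - 1} = (2 * m) choose (m + 1)" .
qed

lemma finite_candidate_parts [simp]:
  "finite {A. A \<subseteq> light m \<and> card A = m + 1}" "finite {B. B \<subseteq> heavy m \<and> card B = m - 1}"
  by (auto intro: finite_subset[of _ "Pow (light m)"] finite_subset[of _ "Pow (heavy m)"])

lemma finite_candidates [simp]: "finite (candidates m)"
  by (simp add: candidates_def)

lemma hard_family_subset: "hard_family m \<subseteq> Pow {..<4 * m}"
  by (auto simp: hard_family_def)

lemma hard_family_mono:
  assumes "X \<subseteq> Y" "Y \<in> hard_family m"
  shows "X \<in> hard_family m"
proof -
  have "card (X \<inter> light m) \<le> card (Y \<inter> light m)" "card (X \<inter> heavy m) \<le> card (Y \<inter> heavy m)"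
    using assms(1) by (auto intro!: card_mono)
  then show ?thesis
    using assms by (auto simp: hard_family_def)
qed

text \<open>Removing a light element leaves at most \<open>m\<close> elements in each half, and removing a heavy one
  leaves \<open>m + 1\<close> light and \<open>m - 2\<close> heavy elements.\<close>

lemma psubset_candidate_in_hard_family:
  assumes "(A, B) \<in> candidates m" "X \<subset> A \<union> B"
  shows "X \<in> hard_family m"
proof -
  have AB: "A \<subseteq> light m" "card A = m + 1" "B \<subseteq> heavy m" "card B = m - 1"
    using assms(1) by (auto simp: candidates_def)
  then have fin: "finite A" "finite B"
    by (auto intro: finite_subset[OF _ finite_halves(1)] finite_subset[OF _ finite_halves(2)])
  have sub: "X \<inter> light m \<subseteq> A" "X \<inter> heavy m \<subseteq> B"
    using assms(2) candidate_Int[OF AB(1,3)] by blast+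
  have X: "X \<subseteq> {..<4 * m}"
    using assms(2) candidate_subset[OF AB(1,3)] by blast
  consider "X \<inter> light m \<subset> A" | "X \<inter> heavy m \<subset> B"
    using sub assms(2) X halves(1)[of m] by blast
  then show ?thesis
  proof cases
    case 1
    then have "card (X \<inter> light m) < m + 1"
      using psubset_card_mono[OF fin(1)] AB(2) by metis
    moreover have "card (X \<inter> heavy m) \<le> m - 1"
      using card_mono[OF fin(2) sub(2)] AB(4) by simp
    ultimately show ?thesis
      using X by (auto simp: hard_family_def)
  next
    case 2
    then have "card (X \<inter> heavy m) < m - 1"
      using psubset_card_mono[OF fin(2)] AB(4) by metis
    moreover have "card (X \<inter> light m) \<le> m + 1"
      using card_mono[OF fin(1) sub(1)] AB(2) by simp
    ultimately show ?thesis
      using X by (auto simp: hard_family_def)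
  qed
qed

lemma hard_weights_in: "hard_weights m \<in> vectors_over {2, 3} (4 * m)"
  by (auto simp: hard_weights_def vectors_over_def)

lemma dot_hard_weights:
  assumes "X \<subseteq> {..<4 * m}"
  shows "dot (hard_weights m) (char_vec (4 * m) X) =
    2 * int (card (X \<inter> light m)) + 3 * int (card (X \<inter> heavy m))"
proof -
  have X: "X = (X \<inter> light m) \<union> (X \<inter> heavy m)"
    using assms halves(1)[of m] by blast
  have "dot (hard_weights m) (char_vec (4 * m) X) = (\<Sum>j\<in>X. hard_weights m ! j)"
    using assms by (rule dot_char_vec)
  also have "\<dots> = (\<Sum>j\<in>X \<inter> light m. hard_weights m ! j) + (\<Sum>j\<in>X \<inter> heavy m. hard_weights m ! j)"
    using halves(2)[of m] by (subst X, subst sum.union_disjoint) auto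
  also have "(\<Sum>j\<in>X \<inter> light m. hard_weights m ! j) = (\<Sum>j\<in>X \<inter> light m. 2)"
    by (rule sum.cong) (auto simp: hard_weights_def light_def nth_append)
  also have "(\<Sum>j\<in>X \<inter> heavy m. hard_weights m ! j) = (\<Sum>j\<in>X \<inter> heavy m. 3)"
    by (rule sum.cong) (auto simp: hard_weights_def heavy_def nth_append)
  finally show ?thesis
    by simp
qed

text \<open>The deficits of the maximal weights \<open>5m\<close> and \<open>5m - 2\<close> of the two kinds of members are
  nonnegative combinations of 2 and 3, so that a weight of \<open>5m - 1\<close> would need a deficit of 1 or
  of \<open>-1\<close>.\<close>

lemma hard_family_weight:
  assumes "X \<in> hard_family m"
  shows "dot (hard_weights m) (char_vec (4 * m) X) \<noteq> 5 * int m - 1"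
proof -
  define a b where "a = card (X \<inter> light m)" and "b = card (X \<inter> heavy m)"
  have "X \<subseteq> {..<4 * m}" and ab: "a \<le> m \<and> b \<le> m \<or> a \<le> m + 2 \<and> b + 2 \<le> m"
    using assms by (simp_all add: hard_family_def a_def b_def)
  then have "dot (hard_weights m) (char_vec (4 * m) X) = 2 * int a + 3 * int b"
    by (simp add: dot_hard_weights a_def b_def)
  also have "\<dots> \<noteq> 5 * int m - 1"
    using ab by presburger
  finally show ?thesis .
qed

lemma candidate_weight:
  assumes "(A, B) \<in> candidates m" "m \<ge> 1"
  shows "dot (hard_weights m) (char_vec (4 * m) (A \<union> B)) = 5 * int m - 1"
proof -
  have AB: "A \<subseteq> light m" "card A = m + 1" "B \<subseteq> heavy m" "card B = m - 1"
    using assms(1) by (auto simp: candidates_def)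
  show ?thesis
    using assms(2) AB(2,4)
    unfolding dot_hard_weights[OF candidate_subset[OF AB(1,3)]] candidate_Int[OF AB(1,3)]
    by (simp add: of_nat_diff)
qed


section \<open>Candidates that beat the hard family\<close>

text \<open>Otherwise there are \<open>a \<in> A - U\<close> and \<open>b \<in> V - B\<close>. Replacing \<open>a\<close> by \<open>b\<close> in the
  first candidate and \<open>b\<close> by \<open>a\<close> in the second gives members of the family, and together they
  have the same value under \<open>v\<close> as the two candidates. So the candidates cannot both beat them.\<close>

lemma beating_pairs_agree:
  assumes "(A, B) \<in> candidates m" "(U, V) \<in> candidates m" "m \<ge> 1"
    and "beats (char_vec (4 * m) ` hard_family m) v (char_vec (4 * m) (A \<union> B))"
    and "beats (char_vec (4 * m) ` hard_family m) v (char_vec (4 * m) (U \<union> V))"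
  shows "A = U \<or> B = V"
proof (rule ccontr)
  assume neq: "\<not> (A = U \<or> B = V)"
  have AB: "A \<subseteq> light m" "card A = m + 1" "B \<subseteq> heavy m" "card B = m - 1"
    and UV: "U \<subseteq> light m" "card U = m + 1" "V \<subseteq> heavy m" "card V = m - 1"
    using assms(1,2) by (auto simp: candidates_def)
  then have fin: "finite A" "finite B" "finite U" "finite V"
    using finite_halves finite_subset by metis+
  have "\<not> A \<subseteq> U"
    using card_subset_eq[OF fin(3)] AB(2) UV(2) neq by metis
  then obtain a where a: "a \<in> A" "a \<notin> U"
    by blast
  have "\<not> V \<subseteq> B"
    using card_subset_eq[OF fin(2)] AB(4) UV(4) neq by metis
  then obtain b where b: "b \<in> V" "b \<notin> B"
    by blast
  have ab: "a \<in> light m" "b \<in> heavy m" "a \<notin> heavy m" "b \<notin> light m"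
    using a b AB UV halves(2)[of m] by auto
  have m2: "card V > 0"
    using b fin(4) card_gt_0_iff by blast
  define X where "X = (A - {a}) \<union> insert b B"
  define Z where "Z = insert a U \<union> (V - {b})"
  have subX: "A - {a} \<subseteq> light m" "insert b B \<subseteq> heavy m"
    and subZ: "insert a U \<subseteq> light m" "V - {b} \<subseteq> heavy m"
    using AB UV ab by auto
  have X: "X \<in> hard_family m"
    using candidate_subset[OF subX] candidate_Int[OF subX] fin a b AB assms(3)
    by (simp add: hard_family_def X_def)
  have Z: "Z \<in> hard_family m"
    using candidate_subset[OF subZ] candidate_Int[OF subZ] fin a b UV m2
    by (simp add: hard_family_def Z_def)
  have sum_split: "(\<Sum>j\<in>P \<union> R. v ! j) = (\<Sum>j\<in>P. v ! j) + (\<Sum>j\<in>R. v ! j)"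
    if "P \<subseteq> light m" "R \<subseteq> heavy m" for P R
    using that halves(2)[of m] finite_subset[OF that(1)] finite_subset[OF that(2)]
    by (intro sum.union_disjoint) auto
  have dot_split: "dot v (char_vec (4 * m) (P \<union> R)) = (\<Sum>j\<in>P. v ! j) + (\<Sum>j\<in>R. v ! j)"
    if "P \<subseteq> light m" "R \<subseteq> heavy m" for P R
    using that by (simp only: dot_char_vec[OF candidate_subset] sum_split)
  have "dot v (char_vec (4 * m) X) < dot v (char_vec (4 * m) (A \<union> B))"
    using assms(4) X by (auto simp: beats_def)
  moreover have "dot v (char_vec (4 * m) Z) < dot v (char_vec (4 * m) (U \<union> V))"
    using assms(5) Z by (auto simp: beats_def)
  moreover have "dot v (char_vec (4 * m) X) =
      (\<Sum>j\<in>A. v ! j) - v ! a + (v ! b + (\<Sum>j\<in>B. v ! j))"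
    unfolding X_def dot_split[OF subX] using fin a b by (simp add: sum_diff1)
  moreover have "dot v (char_vec (4 * m) Z) =
      (v ! a + (\<Sum>j\<in>U. v ! j)) + ((\<Sum>j\<in>V. v ! j) - v ! b)"
    unfolding Z_def dot_split[OF subZ] using fin a b by (simp add: sum_diff1)
  ultimately show False
    by (simp add: dot_split[OF AB(1,3)] dot_split[OF UV(1,3)])
qed

text \<open>Two pairs with different first components share their second component; a third pair differs
  from one of the two in its first component and so has the same second component. Hence \<open>P\<close>
  lies in a single row or column.\<close>

lemma card_pairwise_agreeing:
  assumes "P \<subseteq> A \<times> B" "finite A" "finite B" "card A \<le> N" "card B \<le> N"
    and agree: "\<And>p q. p \<in> P \<Longrightarrow> q \<in> P \<Longrightarrow> fst p = fst q \<or> snd p = snd q"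
  shows "card P \<le> N"
proof (cases "\<exists>p\<in>P. \<exists>q\<in>P. fst p \<noteq> fst q")
  case True
  then obtain p q where "p \<in> P" "q \<in> P" "fst p \<noteq> fst q"
    by blast
  then have "snd r = snd p" if "r \<in> P" for r
    using agree that by metis
  then have "inj_on fst P"
    by (metis inj_onI prod_eqI)
  moreover have "fst ` P \<subseteq> A"
    using assms(1) by auto
  ultimately show ?thesis
    using card_inj_on_le[OF _ _ assms(2)] assms(4) by (meson order_trans)
next
  case False
  then have "inj_on snd P"
    by (auto intro!: inj_onI simp: prod_eq_iff)
  moreover have "snd ` P \<subseteq> B"
    using assms(1) by auto
  ultimately show ?thesis
    using card_inj_on_le[OF _ _ assms(3)] assms(5) by (meson order_trans)
qed

lemma card_beating_candidates:
  fixes m v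
  defines "vec \<equiv> \<lambda>(A, B). char_vec (4 * m) (A \<union> B)"
  assumes "m \<ge> 1"
  shows "card {y \<in> vec ` candidates m. beats (char_vec (4 * m) ` hard_family m) v y}
    \<le> (2 * m) choose (m + 1)"
proof -
  define P where "P = {p \<in> candidates m. beats (char_vec (4 * m) ` hard_family m) v (vec p)}"
  have "P \<subseteq> {A. A \<subseteq> light m \<and> card A = m + 1} \<times> {B. B \<subseteq> heavy m \<and> card B = m - 1}"
    by (auto simp: P_def candidates_def)
  moreover have "fst p = fst q \<or> snd p = snd q" if "p \<in> P" "q \<in> P" for p q
    using that beating_pairs_agree[of "fst p" "snd p" m "fst q" "snd q" v] assms(2)
    by (simp add: P_def vec_def case_prod_beta)
  ultimately have "card P \<le> (2 * m) choose (m + 1)"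
    using card_candidate_parts[OF assms(2)]
    by (intro card_pairwise_agreeing[where P = P]) auto
  moreover have "{y \<in> vec ` candidates m. beats (char_vec (4 * m) ` hard_family m) v y} = vec ` P"
    by (auto simp: P_def)
  moreover have "finite P"
    by (simp add: P_def)
  ultimately show ?thesis
    using card_image_le[of P vec] by simp
qed


section \<open>The query lower bound\<close>

lemma query_lower_bound:
  assumes m: "m \<ge> 1" and solves: "solves init \<delta> (4 * m)"
  obtains w S L f t q x where "problem_instance (4 * m) w S L"
    "run \<delta> L (comparison_oracle f) (init w) t q x" "q \<ge> (2 * m) choose (m + 1)"
proof -
  define N where "N = (2 * m) choose (m + 1)"
  define S where "S = char_vec (4 * m) ` hard_family m"
  define vec where "vec = (\<lambda>(A, B). char_vec (4 * m) (A \<union> B))"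
  define T where "T = vec ` candidates m"
  have "{} \<in> hard_family m"
    by (simp add: hard_family_def)
  then have ind: "independence_system (4 * m) S"
    unfolding S_def using hard_family_subset hard_family_mono
    by (intro independence_system_char_vec) blast+
  have fin: "finite S"
    unfolding S_def using finite_subset[OF hard_family_subset] by simp
  have ind_insert: "independence_system (4 * m) (insert y S)" if y_in: "y \<in> T" for y
  proof -
    obtain A B where AB: "(A, B) \<in> candidates m" and y: "y = char_vec (4 * m) (A \<union> B)"
      using y_in by (auto simp: T_def vec_def)
    have "A \<union> B \<subseteq> {..<4 * m}"
      using AB by (intro candidate_subset) (auto simp: candidates_def)
    then have "independence_system (4 * m) (char_vec (4 * m) ` insert (A \<union> B) (hard_family m))"
      using hard_family_subset hard_family_mono psubset_candidate_in_hard_family[OF AB]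
      by (intro independence_system_char_vec) (blast, blast, metis insert_iff psubsetI)
    then show ?thesis
      by (simp add: S_def y)
  qed
  have weight_T: "dot (hard_weights m) y = 5 * int m - 1" if "y \<in> T" for y
    using that candidate_weight m by (auto simp: T_def vec_def)
  have weight_S: "dot (hard_weights m) x \<noteq> 5 * int m - 1" if "x \<in> S" for x
    using that hard_family_weight by (auto simp: S_def)
  have few: "card {y \<in> T. beats S v y} \<le> N" for v
    unfolding T_def S_def N_def vec_def using m by (rule card_beating_candidates)
  have "finite T"
    by (simp add: T_def)
  then obtain L f t q x where 1: "problem_instance (4 * m) (hard_weights m) S L"
    "run \<delta> L (comparison_oracle f) (init (hard_weights m)) t q x" "card T \<le> q * N"
    using adversary_bound[OF hard_weights_in ind fin ind_insert _ weight_T weight_S few solves]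
    by blast
  have "card T = card (candidates m)"
    unfolding T_def vec_def by (rule card_image[OF inj_on_candidates])
  also have "\<dots> = N * N"
    unfolding candidates_def card_cartesian_product using m
    by (simp only: card_candidate_parts N_def)
  finally have "N * N \<le> q * N"
    using 1(3) by simp
  moreover have "N > 0"
    using m by (simp add: N_def)
  ultimately have "N \<le> q"
    by simp
  with 1(1,2) show thesis
    using that unfolding N_def by blast
qed


section \<open>Exponential growth\<close>

lemma choose_ge_power2:
  assumes "m \<ge> 2"
  shows "(2 * m) choose (m + 1) \<ge> 2 ^ m"
  using assms
proof (induction m rule: dec_induct)
  case base
  show ?case by (simp add: numeral_eq_Suc)
next
  case (step m)
  have "2 * Suc m choose (Suc m + 1) =
      (2 * m choose m) + 2 * (2 * m choose (m + 1)) + (2 * m choose (m + 2))"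
    by simp
  then show ?case
    using step.IH by simp
qed

lemma poly_nat_le_power:
  fixes p :: "nat poly"
  assumes "n \<ge> 1"
  shows "poly p n \<le> poly p 1 * n ^ degree p"
proof -
  have "poly p n = (\<Sum>i\<le>degree p. coeff p i * n ^ i)"
    by (rule poly_altdef)
  also have "\<dots> \<le> (\<Sum>i\<le>degree p. coeff p i * n ^ degree p)"
    using assms by (intro sum_mono mult_left_mono power_increasing) auto
  also have "\<dots> = poly p 1 * n ^ degree p"
    by (simp add: poly_altdef sum_distrib_right)
  finally show ?thesis .
qed

lemma poly_less_power2:
  fixes p :: "nat poly"
  shows "\<exists>m\<ge>2. poly p (4 * m) < 2 ^ m"
proof -
  define K d where "K = real (poly p 1)" and "d = degree p"
  have "(\<lambda>m. K * (4 * real m) ^ d / 2 ^ m) \<longlonglongrightarrow> 0"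
    by real_asymp
  then have "eventually (\<lambda>m. K * (4 * real m) ^ d / 2 ^ m < 1) sequentially"
    by (rule order_tendstoD) simp
  with eventually_ge_at_top[of 2]
  have "eventually (\<lambda>m. m \<ge> 2 \<and> K * (4 * real m) ^ d / 2 ^ m < 1) sequentially"
    by eventually_elim simp
  then obtain m where m: "m \<ge> 2" "K * (4 * real m) ^ d < 2 ^ m"
    by (auto simp: eventually_sequentially field_simps)
  have "real (poly p 1 * (4 * m) ^ d) < real (2 ^ m)"
    using m(2) by (simp add: K_def)
  then have "poly p 1 * (4 * m) ^ d < 2 ^ m"
    by (simp only: of_nat_less_iff)
  with m(1) poly_nat_le_power[of "4 * m" p] show ?thesis
    unfolding d_def by (intro exI[of _ m]) auto
qed


section \<open>The lower bounds\<close>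

theorem theorem7p1:
  "\<not> (\<exists>N P. oracle_turing_machine N P \<and>
         (\<forall>n \<ge> 1. solves tm_init (tm_step P) n) \<and>
         polynomial_time tm_init (tm_step P)) \<and>
   (\<forall>m :: nat. m \<ge> 2 \<longrightarrow>
      (\<forall>(init :: int list \<Rightarrow> 'c) \<delta>. solves init \<delta> (4 * m) \<longrightarrow>
         (\<exists>w S L f t q x. problem_instance (4 * m) w S L \<and>
            run \<delta> L (comparison_oracle f) (init w) t q x \<and>
            q \<ge> (2 * m) choose (m + 1))) \<and>
      (2 * m) choose (m + 1) \<ge> 2 ^ m)"
proof (intro conjI allI impI notI)
  assume "\<exists>N P. oracle_turing_machine N P \<and> (\<forall>n \<ge> 1. solves tm_init (tm_step P) n) \<and>
    polynomial_time tm_init (tm_step P)"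
  then obtain P where solves: "\<And>n. n \<ge> 1 \<Longrightarrow> solves tm_init (tm_step P) n"
    and "polynomial_time tm_init (tm_step P)"
    by blast
  then obtain p :: "nat poly" where p: "\<And>n w S L f t q x. n \<ge> 1 \<Longrightarrow> problem_instance n w S L \<Longrightarrow>
      run (tm_step P) L (comparison_oracle f) (tm_init w) t q x \<Longrightarrow> t \<le> poly p n"
    unfolding polynomial_time_def by blast
  obtain m where m: "m \<ge> 2" "poly p (4 * m) < 2 ^ m"
    using poly_less_power2 by blast
  then have "m \<ge> 1" "4 * m \<ge> 1"
    by simp_all
  then obtain w S L f t q x where 1: "problem_instance (4 * m) w S L"
    "run (tm_step P) L (comparison_oracle f) (tm_init w) t q x" "q \<ge> (2 * m) choose (m + 1)"
    using query_lower_bound solves by metis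
  have "2 ^ m \<le> q"
    using choose_ge_power2[OF m(1)] 1(3) by simp
  also have "q \<le> t"
    using 1(2) by (rule run_queries_le_steps)
  also have "t \<le> poly p (4 * m)"
    using p[OF \<open>4 * m \<ge> 1\<close> 1(1,2)] .
  finally show False
    using m(2) by simp
next
  fix m :: nat and init :: "int list \<Rightarrow> 'c" and \<delta>
  assume "m \<ge> 2" "solves init \<delta> (4 * m)"
  then have "m \<ge> 1" and *: "solves init \<delta> (4 * m)"
    by simp_all
  then show "\<exists>w S L f t q x. problem_instance (4 * m) w S L \<and>
      run \<delta> L (comparison_oracle f) (init w) t q x \<and> q \<ge> (2 * m) choose (m + 1)"
    by (rule query_lower_bound) blast
next
  fix m :: nat
  assume "m \<ge> 2"
  then show "(2 * m) choose (m + 1) \<ge> 2 ^ m"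
    by (rule choose_ge_power2)
qed

end
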